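(* Let $\Gamma_0\Rightarrow\Delta_0$ be a sequent not derivable in $\mathsf{G3T}^{i}$. Then there is a finite Kripke model with at most $4^{|\Sigma|}$ worlds, where $\Sigma=\mathrm{Sub}(\Gamma_0\cup\Delta_0)$, and a world of it at which every formula of $\Gamma_0$ is forced and no formula of $\Delta_0$ is forced. Consequently $\Gamma_0\Rightarrow\Delta_0$ is derivable in $\mathsf{G3T}^{i}$ if and only if it is valid.
   Context: Formulae are generated from a countable set $\mathit{Var}$ of propositional variables by $A ::= p \mid \bot \mid A\land A \mid A\lor A \mid A\to A$. $\mathrm{Sub}(X)$ denotes the set of all subformulae of the formulae in the set or multiset $X$. A Kripke model is $\mathcal M=(W,\le,V)$ with $W$ non-empty, $\le$ a preorder on $W$, and $V\colon W\to\mathcal P(\mathit{Var})$ monotone ($w\le v$ implies $V(w)\subseteq V(v)$). Forcing: $w\Vdash p$ iff $p\in V(w)$; never $w\Vdash\bot$; $w\Vdash A\land B$ iff $w\Vdash A$ and $w\Vdash B$; $w\Vdash A\lor B$ iff $w\Vdash A$ or $w\Vdash B$; $w\Vdash A\to B$ iff for every $v\ge w$, $v\Vdash A$ implies $v\Vdash B$. A sequent $\Gamma\Rightarrow\Delta$ is valid if for every model and every world $w$, if $w\Vdash A$ for all $A\in\Gamma$ then $w\Vdash B$ for some $B\in\Delta$. The calculus $\mathsf{G3T}^{i}$. Sequents $\Gamma\Rightarrow\Delta$ have $\Gamma,\Delta$ finite multisets of formulae. Initial sequents: $p,\Gamma\Rightarrow\Delta,p$ ($p$ a variable) and $\bot,\Gamma\Rightarrow\Delta$.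 Rules (premisses / conclusion): - $\land\mathrm L$: $A,B,\Gamma\Rightarrow\Delta$ / $A\land B,\Gamma\Rightarrow\Delta$. - $\lor\mathrm L$: $A,\Gamma\Rightarrow\Delta$ and $B,\Gamma\Rightarrow\Delta$ / $A\lor B,\Gamma\Rightarrow\Delta$. - $\to\!\mathrm L$: $A\to B,\Gamma\Rightarrow\Delta,A$ and $B,\Gamma\Rightarrow\Delta$ / $A\to B,\Gamma\Rightarrow\Delta$. - $\land\mathrm R$: $\Gamma\Rightarrow\Delta,A$ and $\Gamma\Rightarrow\Delta,B$ / $\Gamma\Rightarrow\Delta,A\land B$. - $\lor\mathrm R$: $\Gamma\Rightarrow\Delta,A,B$ / $\Gamma\Rightarrow\Delta,A\lor B$. - $\to\!\mathrm R$: $A,\Gamma\Rightarrow B$ / $\Gamma\Rightarrow\Delta,A\to B$. *)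

theory Defs
  imports "HOL-Library.Multiset" "HOL-Library.Countable"
begin

datatype 'v form =
    Var 'v
  | Bot
  | And "'v form" "'v form"
  | Or "'v form" "'v form"
  | Imp "'v form" "'v form"

primrec subforms :: "'v form \<Rightarrow> 'v form set" where
  "subforms (Var p) = {Var p}"
| "subforms Bot = {Bot}"
| "subforms (And A B) = insert (And A B) (subforms A \<union> subforms B)"
| "subforms (Or A B) = insert (Or A B) (subforms A \<union> subforms B)"
| "subforms (Imp A B) = insert (Imp A B) (subforms A \<union> subforms B)"

definition Sub :: "'v form set \<Rightarrow> 'v form set" where
  "Sub X = (\<Union>A\<in>X. subforms A)"

record ('w, 'v) kripke =
  worlds :: "'w set"
  acc :: "'w rel"
  val :: "'w \<Rightarrow> 'v set"

text \<open>Note that \<open>preorder_on W r\<close> includes \<open>r \<subseteq> W \<times> W\<close>, so all successors of a world are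
  worlds. The values of \<open>val\<close> outside \<open>worlds\<close> are irrelevant.\<close>

definition kripke_model :: "('w, 'v) kripke \<Rightarrow> bool" where
  "kripke_model M \<longleftrightarrow>
     worlds M \<noteq> {} \<and>
     preorder_on (worlds M) (acc M) \<and>
     (\<forall>w v. (w, v) \<in> acc M \<longrightarrow> val M w \<subseteq> val M v)"

primrec forces :: "('w, 'v) kripke \<Rightarrow> 'w \<Rightarrow> 'v form \<Rightarrow> bool" where
  "forces M w (Var p) \<longleftrightarrow> p \<in> val M w"
| "forces M w Bot \<longleftrightarrow> False"
| "forces M w (And A B) \<longleftrightarrow> forces M w A \<and> forces M w B"
| "forces M w (Or A B) \<longleftrightarrow> forces M w A \<or> forces M w B"
| "forces M w (Imp A B) \<longleftrightarrow> (\<forall>v. (w, v) \<in> acc M \<longrightarrow> forces M v A \<longrightarrow> forces M v B)"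

text \<open>A formula of HOL cannot quantify over types, so validity carries the type \<open>'w\<close> of potential
  worlds as a parameter: it refers to all models whose set of worlds is a non-empty subset of
  \<open>'w\<close>.\<close>

definition valid :: "'w itself \<Rightarrow> 'v form multiset \<Rightarrow> 'v form multiset \<Rightarrow> bool" where
  "valid (T :: 'w itself) \<Gamma> \<Delta> \<longleftrightarrow>
     (\<forall>(M :: ('w, 'v) kripke) w.
        kripke_model M \<longrightarrow> w \<in> worlds M \<longrightarrow>
        (\<forall>A\<in>#\<Gamma>. forces M w A) \<longrightarrow> (\<exists>B\<in>#\<Delta>. forces M w B))"

inductive G3Ti :: "'v form multiset \<Rightarrow> 'v form multiset \<Rightarrow> bool" where
  Init: "G3Ti (add_mset (Var p) \<Gamma>) (add_mset (Var p) \<Delta>)"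
| BotL: "G3Ti (add_mset Bot \<Gamma>) \<Delta>"
| AndL: "G3Ti (add_mset A (add_mset B \<Gamma>)) \<Delta> \<Longrightarrow> G3Ti (add_mset (And A B) \<Gamma>) \<Delta>"
| OrL: "G3Ti (add_mset A \<Gamma>) \<Delta> \<Longrightarrow> G3Ti (add_mset B \<Gamma>) \<Delta> \<Longrightarrow>
    G3Ti (add_mset (Or A B) \<Gamma>) \<Delta>"
| ImpL: "G3Ti (add_mset (Imp A B) \<Gamma>) (add_mset A \<Delta>) \<Longrightarrow> G3Ti (add_mset B \<Gamma>) \<Delta> \<Longrightarrow>
    G3Ti (add_mset (Imp A B) \<Gamma>) \<Delta>"
| AndR: "G3Ti \<Gamma> (add_mset A \<Delta>) \<Longrightarrow> G3Ti \<Gamma> (add_mset B \<Delta>) \<Longrightarrow>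
    G3Ti \<Gamma> (add_mset (And A B) \<Delta>)"
| OrR: "G3Ti \<Gamma> (add_mset A (add_mset B \<Delta>)) \<Longrightarrow> G3Ti \<Gamma> (add_mset (Or A B) \<Delta>)"
| ImpR: "G3Ti (add_mset A \<Gamma>) {#B#} \<Longrightarrow> G3Ti \<Gamma> (add_mset (Imp A B) \<Delta>)"

end

theory Submission
  imports Defs
begin

text \<open>
  Soundness is an induction on derivations. The only rule that is not local to one world is
  \<open>\<rightarrow>R\<close>: its premiss is used at an arbitrary later world, where \<open>\<Gamma>\<close> is still forced by persistence,
  while \<open>\<Delta>\<close>, which need not stay refuted, has been dropped.

  Completeness reads the rules backwards. If the conclusion of a rule is underivable, then so is one
  of its premisses; hence bottom-up search from an underivable sequent can be steered around all
  initial sequents. The idea is to keep, next to the current sequent \<open>\<Gamma> \<Rightarrow> \<Delta>\<close>, the sets \<open>S\<close> and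
  \<open>T\<close> of the formulae that have so far occurred on its left and on its right, and to build the
  model from the pairs \<open>(S, T)\<close>. A formula that is in \<open>S\<close> but no longer in \<open>\<Gamma>\<close> has been
  decomposed: \<open>S\<close> contains enough of its components to force it, so nothing is lost when it
  disappears. Variables, \<open>\<bottom>\<close> and, on the right, implications never disappear. The records thus do
  the work of weakening and contraction.

  The rule \<open>\<rightarrow>L\<close> repeats its principal formula \<open>A \<rightarrow> B\<close>, which would make the search infinite; it is
  applied only while \<open>A\<close> is not yet in \<open>T\<close>. As everything happens inside the finite set \<open>\<Sigma>\<close> of
  subformulae, the search then ends in a saturated state (lemma \<open>saturation\<close>). The pairs \<open>(S, T)\<close>
  of saturated states, ordered by inclusion of the left components, form the worlds. For
  \<open>A \<rightarrow> B\<close> in \<open>T\<close> the required later world is found by applying \<open>\<rightarrow>R\<close>, adding \<open>A\<close> to \<open>S\<close>,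
  replacing \<open>T\<close> by \<open>{B}\<close> and saturating again; \<open>S\<close> is kept, so this is a step upwards. An
  induction on formulae (lemma \<open>truth_lemma\<close>) shows that each world forces its left component and
  refutes its right one. As \<open>S\<close> and \<open>T\<close> are subsets of \<open>\<Sigma>\<close>, there are at most
  \<open>2\<^sup>n \<cdot> 2\<^sup>n = 4\<^sup>n\<close> worlds, where \<open>n\<close> is the number of elements of \<open>\<Sigma>\<close>.
\<close>

section \<open>Soundness\<close>

lemma forces_persistent:
  assumes "kripke_model M" "(w, v) \<in> acc M" "forces M w A"
  shows "forces M v A"
  using assms
proof (induction A arbitrary: w v)
  case (Var p)
  then show ?case by (auto simp: kripke_model_def)
next
  case (Imp A B)
  have "trans (acc M)" using Imp.prems(1) by (simp add: kripke_model_def preorder_on_def)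
  then show ?case using Imp.prems by (auto dest: transD)
qed auto

lemma soundness_at_world:
  assumes "G3Ti \<Gamma> \<Delta>" "kripke_model M" "w \<in> worlds M" "\<forall>A\<in>#\<Gamma>. forces M w A"
  shows "\<exists>B\<in>#\<Delta>. forces M w B"
  using assms(1,3,4)
proof (induction arbitrary: w)
  case (ImpL A B \<Gamma> \<Delta>)
  have "(w, w) \<in> acc M"
    using assms(2) ImpL.prems by (auto simp: kripke_model_def preorder_on_def refl_on_def)
  then show ?case using ImpL by fastforce
next
  case (ImpR A \<Gamma> B \<Delta>)
  have "forces M v B" if "(w, v) \<in> acc M" "forces M v A" for v
  proof -
    have "v \<in> worlds M"
      using assms(2) that by (auto simp: kripke_model_def preorder_on_def)
    moreover have "\<forall>C\<in>#add_mset A \<Gamma>. forces M v C"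
      using that ImpR.prems forces_persistent[OF assms(2) that(1)] by auto
    ultimately show ?thesis using ImpR.IH by fastforce
  qed
  then show ?case by simp
next
  case (AndR \<Gamma> A \<Delta> B)
  show ?case using AndR.IH[of w] AndR.prems by auto
next
  case (OrR \<Gamma> A B \<Delta>)
  show ?case using OrR.IH[of w] OrR.prems by auto
next
  case (OrL A \<Gamma> \<Delta> B)
  show ?case using OrL.IH[of w] OrL.prems by auto
next
  case (AndL A B \<Gamma> \<Delta>)
  show ?case using AndL.IH[of w] AndL.prems by auto
qed auto

corollary soundness: "G3Ti \<Gamma> \<Delta> \<Longrightarrow> valid TYPE('w) \<Gamma> \<Delta>"
  unfolding valid_def by (intro allI impI) (rule soundness_at_world)

section \<open>Subformulae\<close>

lemma subforms_refl: "A \<in> subforms A"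
  by (cases A) auto

lemma subforms_trans: "B \<in> subforms A \<Longrightarrow> subforms B \<subseteq> subforms A"
  by (induction A) auto

lemma finite_subforms: "finite (subforms A)"
  by (induction A) auto

definition subformula_closed :: "'v form set \<Rightarrow> bool" where
  "subformula_closed \<Sigma> \<longleftrightarrow> (\<forall>A\<in>\<Sigma>. subforms A \<subseteq> \<Sigma>)"

lemma subformula_closed_Sub: "subformula_closed (Sub X)"
  unfolding subformula_closed_def Sub_def using subforms_trans by blast

lemma subset_Sub: "X \<subseteq> Sub X"
  unfolding Sub_def using subforms_refl by blast

lemma finite_Sub: "finite X \<Longrightarrow> finite (Sub X)"
  unfolding Sub_def using finite_subforms by blast

lemma subformula_closedD:
  assumes "subformula_closed \<Sigma>"
  shows "And A B \<in> \<Sigma> \<Longrightarrow> A \<in> \<Sigma> \<and> B \<in> \<Sigma>"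
    and "Or A B \<in> \<Sigma> \<Longrightarrow> A \<in> \<Sigma> \<and> B \<in> \<Sigma>"
    and "Imp A B \<in> \<Sigma> \<Longrightarrow> A \<in> \<Sigma> \<and> B \<in> \<Sigma>"
  using assms subforms_refl[of A] subforms_refl[of B]
  unfolding subformula_closed_def by fastforce+

section \<open>Bottom-up search with a record of past formulae\<close>

text \<open>The two predicates say that a formula may be absent from the current sequent because the
  recorded formulae already force it, or refute it, respectively. For an implication on the left
  the case that its antecedent is recorded on the right does not count: that record is discarded by
  \<open>\<rightarrow>R\<close>, and the implication must then be available again.\<close>

fun decomposedL :: "'v form set \<Rightarrow> 'v form \<Rightarrow> bool" where
  "decomposedL S (And A B) \<longleftrightarrow> A \<in> S \<and> B \<in> S"
| "decomposedL S (Or A B) \<longleftrightarrow> A \<in> S \<or> B \<in> S"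
| "decomposedL S (Imp A B) \<longleftrightarrow> B \<in> S"
| "decomposedL S _ \<longleftrightarrow> False"

fun decomposedR :: "'v form set \<Rightarrow> 'v form \<Rightarrow> bool" where
  "decomposedR T (And A B) \<longleftrightarrow> A \<in> T \<or> B \<in> T"
| "decomposedR T (Or A B) \<longleftrightarrow> A \<in> T \<and> B \<in> T"
| "decomposedR T _ \<longleftrightarrow> False"

lemma decomposedL_mono: "decomposedL S A \<Longrightarrow> S \<subseteq> S' \<Longrightarrow> decomposedL S' A"
  by (cases A) auto

lemma decomposedR_mono: "decomposedR T A \<Longrightarrow> T \<subseteq> T' \<Longrightarrow> decomposedR T' A"
  by (cases A) auto

definition search_state ::
  "'v form set \<Rightarrow> 'v form set \<Rightarrow> 'v form set \<Rightarrow> 'v form multiset \<Rightarrow> 'v form multiset \<Rightarrow> bool"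
  where
  "search_state \<Sigma> S T \<Gamma> \<Delta> \<longleftrightarrow>
     \<not> G3Ti \<Gamma> \<Delta> \<and> S \<subseteq> \<Sigma> \<and> T \<subseteq> \<Sigma> \<and> set_mset \<Gamma> \<subseteq> S \<and> set_mset \<Delta> \<subseteq> T \<and>
     (\<forall>A\<in>S. A \<in># \<Gamma> \<or> decomposedL S A) \<and> (\<forall>A\<in>T. A \<in># \<Delta> \<or> decomposedR T A)"

text \<open>A single schema covers the backward application of every rule except \<open>\<rightarrow>R\<close>: the active
  formulae enter the record, and what leaves the sequent has been decomposed.\<close>

lemma search_state_step:
  assumes "search_state \<Sigma> S T \<Gamma> \<Delta>" "\<not> G3Ti \<Gamma>' \<Delta>'"
    and "S' = S \<union> set_mset \<Gamma>'" "T' = T \<union> set_mset \<Delta>'"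
    and "set_mset \<Gamma>' \<subseteq> \<Sigma>" "set_mset \<Delta>' \<subseteq> \<Sigma>"
    and "\<forall>A\<in>#\<Gamma>. A \<in># \<Gamma>' \<or> decomposedL S' A"
    and "\<forall>A\<in>#\<Delta>. A \<in># \<Delta>' \<or> decomposedR T' A"
  shows "search_state \<Sigma> S' T' \<Gamma>' \<Delta>'"
  using assms decomposedL_mono[of S _ S'] decomposedR_mono[of T _ T']
  unfolding search_state_def by blast

definition saturatedL :: "'v form set \<Rightarrow> 'v form \<Rightarrow> bool" where
  "saturatedL T F \<longleftrightarrow> (\<exists>p. F = Var p) \<or> (\<exists>A B. F = Imp A B \<and> A \<in> T)"

definition saturatedR :: "'v form \<Rightarrow> bool" where
  "saturatedR F \<longleftrightarrow> (\<forall>A B. F \<noteq> And A B \<and> F \<noteq> Or A B)"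

definition saturated_state ::
  "'v form set \<Rightarrow> 'v form set \<Rightarrow> 'v form set \<Rightarrow> 'v form multiset \<Rightarrow> 'v form multiset \<Rightarrow> bool"
  where
  "saturated_state \<Sigma> S T \<Gamma> \<Delta> \<longleftrightarrow> search_state \<Sigma> S T \<Gamma> \<Delta> \<and>
     (\<forall>F\<in>#\<Gamma>. saturatedL T F) \<and> (\<forall>F\<in>#\<Delta>. saturatedR F)"

abbreviation weight :: "'v form multiset \<Rightarrow> nat" where
  "weight \<Gamma> \<equiv> (\<Sum>F\<in>#\<Gamma>. size F)"

text \<open>Every rule replaces its principal formula by smaller ones, except for the left premiss of
  \<open>\<rightarrow>L\<close>. That premiss is taken only if it records a new formula on the right, which the first
  component of the measure counts.\<close>

definition progress ::
  "'v form set \<Rightarrow> (('v form set \<times> 'v form multiset \<times> 'v form multiset) \<times>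
     ('v form set \<times> 'v form multiset \<times> 'v form multiset)) set"
  where
  "progress \<Sigma> = measures [\<lambda>(T, \<Gamma>, \<Delta>). card (\<Sigma> - T), \<lambda>(T, \<Gamma>, \<Delta>). weight \<Gamma> + weight \<Delta>]"

lemma progress_weight:
  assumes "finite \<Sigma>" "T \<subseteq> T'" "weight \<Gamma>' + weight \<Delta>' < weight \<Gamma> + weight \<Delta>"
  shows "((T', \<Gamma>', \<Delta>'), (T, \<Gamma>, \<Delta>)) \<in> progress \<Sigma>"
proof -
  have "card (\<Sigma> - T') \<le> card (\<Sigma> - T)" using assms by (intro card_mono) auto
  then show ?thesis using assms(3) by (auto simp: progress_def)
qed

lemma progress_record:
  assumes "finite \<Sigma>" "T \<subseteq> T'" "A \<in> \<Sigma>" "A \<in> T'" "A \<notin> T"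
  shows "((T', \<Gamma>', \<Delta>'), (T, \<Gamma>, \<Delta>)) \<in> progress \<Sigma>"
proof -
  have "card (\<Sigma> - T') < card (\<Sigma> - T)" using assms by (intro psubset_card_mono) auto
  then show ?thesis by (simp add: progress_def)
qed

lemma unsaturated_step:
  assumes fin: "finite \<Sigma>" and cl: "subformula_closed \<Sigma>"
    and st: "search_state \<Sigma> S T \<Gamma> \<Delta>" and unsat: "\<not> saturated_state \<Sigma> S T \<Gamma> \<Delta>"
  shows "\<exists>S' T' \<Gamma>' \<Delta>'. search_state \<Sigma> S' T' \<Gamma>' \<Delta>' \<and> S \<subseteq> S' \<and> T \<subseteq> T' \<and>
           ((T', \<Gamma>', \<Delta>'), (T, \<Gamma>, \<Delta>)) \<in> progress \<Sigma>"
proof -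
  have und: "\<not> G3Ti \<Gamma> \<Delta>" and in\<Sigma>: "set_mset \<Gamma> \<subseteq> \<Sigma>" "set_mset \<Delta> \<subseteq> \<Sigma>"
    using st by (auto simp: search_state_def)
  note closed = subformula_closedD[OF cl]
  note step = search_state_step[OF st _ refl refl]
  \<comment> \<open>It is enough to name an underivable premiss; its record is then determined.\<close>
  have goal: ?thesis
    if "\<not> G3Ti \<Gamma>' \<Delta>'" "set_mset \<Gamma>' \<subseteq> \<Sigma>" "set_mset \<Delta>' \<subseteq> \<Sigma>"
      "\<forall>A\<in>#\<Gamma>. A \<in># \<Gamma>' \<or> decomposedL (S \<union> set_mset \<Gamma>') A"
      "\<forall>A\<in>#\<Delta>. A \<in># \<Delta>' \<or> decomposedR (T \<union> set_mset \<Delta>') A"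
      "weight \<Gamma>' + weight \<Delta>' < weight \<Gamma> + weight \<Delta> \<or> (\<exists>A\<in>#\<Delta>'. A \<notin> T)"
    for \<Gamma>' \<Delta>'
  proof -
    have "((T \<union> set_mset \<Delta>', \<Gamma>', \<Delta>'), (T, \<Gamma>, \<Delta>)) \<in> progress \<Sigma>"
      using that(6)
    proof
      assume "\<exists>A\<in>#\<Delta>'. A \<notin> T"
      then obtain A where "A \<in># \<Delta>'" "A \<notin> T" by blast
      then show ?thesis using that(3) by (intro progress_record[OF fin, of _ _ A]) auto
    qed (intro progress_weight[OF fin], auto)
    then show ?thesis using step[OF that(1-5)] by blast
  qed
  from unsat st consider F where "F \<in># \<Gamma>" "\<not> saturatedL T F" | F where "F \<in># \<Delta>" "\<not> saturatedR F"
    by (auto simp: saturated_state_def)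
  then show ?thesis
  proof cases
    case (1 F)
    from 1(1) obtain \<Gamma>1 where \<Gamma>: "\<Gamma> = add_mset F \<Gamma>1" by (blast dest: multi_member_split)
    show ?thesis
    proof (cases F)
      case (Var p)
      then show ?thesis using 1 by (simp add: saturatedL_def)
    next
      case Bot
      then show ?thesis using und \<Gamma> by (simp add: G3Ti.BotL)
    next
      case (And A B)
      then have "\<not> G3Ti (add_mset A (add_mset B \<Gamma>1)) \<Delta>" using und \<Gamma> by (auto intro: G3Ti.AndL)
      then show ?thesis
        by (rule goal) (use And \<Gamma> in\<Sigma> closed(1)[of A B] in auto)
    next
      case (Or A B)
      then have "\<not> G3Ti (add_mset A \<Gamma>1) \<Delta> \<or> \<not> G3Ti (add_mset B \<Gamma>1) \<Delta>"
        using und \<Gamma> by (auto intro: G3Ti.OrL)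
      then show ?thesis
        by (elim disjE) (erule goal; use Or \<Gamma> in\<Sigma> closed(2)[of A B] in auto)+
    next
      case (Imp A B)
      then have "A \<notin> T" using 1 by (simp add: saturatedL_def)
      have "\<not> G3Ti \<Gamma> (add_mset A \<Delta>) \<or> \<not> G3Ti (add_mset B \<Gamma>1) \<Delta>"
        using Imp und \<Gamma> by (auto intro: G3Ti.ImpL)
      then show ?thesis
        by (elim disjE)
          (erule goal; use Imp \<Gamma> in\<Sigma> closed(3)[of A B] \<open>A \<notin> T\<close> in auto)+
    qed
  next
    case (2 F)
    from 2(1) obtain \<Delta>1 where \<Delta>: "\<Delta> = add_mset F \<Delta>1" by (blast dest: multi_member_split)
    from 2(2) consider A B where "F = And A B" | A B where "F = Or A B"
      by (auto simp: saturatedR_def)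
    then show ?thesis
    proof cases
      case (1 A B)
      then have "\<not> G3Ti \<Gamma> (add_mset A \<Delta>1) \<or> \<not> G3Ti \<Gamma> (add_mset B \<Delta>1)"
        using und \<Delta> by (auto intro: G3Ti.AndR)
      then show ?thesis
        by (elim disjE) (erule goal; use 1 \<Delta> in\<Sigma> closed(1)[of A B] in auto)+
    next
      case (2 A B)
      then have "\<not> G3Ti \<Gamma> (add_mset A (add_mset B \<Delta>1))" using und \<Delta> by (auto intro: G3Ti.OrR)
      then show ?thesis
        by (rule goal) (use 2 \<Delta> in\<Sigma> closed(2)[of A B] in auto)
    qed
  qed
qed

lemma saturation:
  assumes "finite \<Sigma>" "subformula_closed \<Sigma>" "search_state \<Sigma> S T \<Gamma> \<Delta>"
  shows "\<exists>S' T' \<Gamma>' \<Delta>'. saturated_state \<Sigma> S' T' \<Gamma>' \<Delta>' \<and> S \<subseteq> S' \<and> T \<subseteq> T'"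
proof -
  have "wf (progress \<Sigma>)" by (simp add: progress_def)
  then show ?thesis using assms(3)
  proof (induction "(T, \<Gamma>, \<Delta>)" arbitrary: S T \<Gamma> \<Delta> rule: wf_induct_rule)
    case less
    show ?case
    proof (cases "saturated_state \<Sigma> S T \<Gamma> \<Delta>")
      case False
      then show ?thesis
        using unsaturated_step[OF assms(1,2) less.prems] less.hyps by (meson order_trans)
    qed blast
  qed
qed

section \<open>Models from Hintikka pairs\<close>

text \<open>These conditions on a set of pairs are what the truth lemma needs. The one for
  implications on the right is the only one that relates different pairs.\<close>

locale hintikka_system =
  fixes W :: "('v form set \<times> 'v form set) set"
  assumes Bot_left: "(S, T) \<in> W \<Longrightarrow> Bot \<notin> S"
    and Var_left: "(S, T) \<in> W \<Longrightarrow> Var p \<in> S \<Longrightarrow> Var p \<notin> T"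
    and And_left: "(S, T) \<in> W \<Longrightarrow> And A B \<in> S \<Longrightarrow> A \<in> S \<and> B \<in> S"
    and Or_left: "(S, T) \<in> W \<Longrightarrow> Or A B \<in> S \<Longrightarrow> A \<in> S \<or> B \<in> S"
    and Imp_left: "(S, T) \<in> W \<Longrightarrow> Imp A B \<in> S \<Longrightarrow> A \<in> T \<or> B \<in> S"
    and And_right: "(S, T) \<in> W \<Longrightarrow> And A B \<in> T \<Longrightarrow> A \<in> T \<or> B \<in> T"
    and Or_right: "(S, T) \<in> W \<Longrightarrow> Or A B \<in> T \<Longrightarrow> A \<in> T \<and> B \<in> T"
    and Imp_right: "(S, T) \<in> W \<Longrightarrow> Imp A B \<in> T \<Longrightarrow>
      \<exists>S' T'. (S', T') \<in> W \<and> S \<subseteq> S' \<and> A \<in> S' \<and> B \<in> T'"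

definition pair_model ::
  "('v form set \<times> 'v form set) set \<Rightarrow> ('v form set \<times> 'v form set, 'v) kripke" where
  "pair_model W = \<lparr>worlds = W, acc = {(x, y) \<in> W \<times> W. fst x \<subseteq> fst y},
                   val = \<lambda>x. {p. Var p \<in> fst x}\<rparr>"

lemma kripke_model_pair_model: "W \<noteq> {} \<Longrightarrow> kripke_model (pair_model W)"
  by (auto simp: kripke_model_def pair_model_def preorder_on_def refl_on_def trans_def)

text \<open>Both halves have to be proved together: an implication in \<open>S\<close> is forced because its
  antecedent, if it is in the right component of a later pair, is refuted there.\<close>

lemma (in hintikka_system) truth_lemma:
  assumes "(S, T) \<in> W"
  shows "(A \<in> S \<longrightarrow> forces (pair_model W) (S, T) A) \<and>
         (A \<in> T \<longrightarrow> \<not> forces (pair_model W) (S, T) A)"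
  using assms
proof (induction A arbitrary: S T)
  case (Var p)
  then show ?case using Var_left[OF Var] by (auto simp: pair_model_def)
next
  case Bot
  then show ?case using Bot_left[OF Bot] by simp
next
  case (And A B)
  show ?case
    using And_left[OF And.prems] And_right[OF And.prems] And.IH[OF And.prems]
    by (meson forces.simps)
next
  case (Or A B)
  show ?case
    using Or_left[OF Or.prems] Or_right[OF Or.prems] Or.IH[OF Or.prems]
    by (meson forces.simps)
next
  case (Imp A B)
  have acc: "(x, y) \<in> acc (pair_model W) \<longleftrightarrow> x \<in> W \<and> y \<in> W \<and> fst x \<subseteq> fst y" for x y
    by (auto simp: pair_model_def)
  show ?case
  proof (intro conjI impI)
    assume Imp_S: "Imp A B \<in> S"
    have "forces (pair_model W) (S', T') B"
      if "(S', T') \<in> W" "S \<subseteq> S'" "forces (pair_model W) (S', T') A" for S' T'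
      using Imp_left[OF that(1), of A B] Imp_S Imp.IH[OF that(1)] that by blast
    then show "forces (pair_model W) (S, T) (Imp A B)" by (auto simp: acc)
  next
    assume "Imp A B \<in> T"
    then obtain S' T' where "(S', T') \<in> W" "S \<subseteq> S'" "A \<in> S'" "B \<in> T'"
      using Imp_right[OF Imp.prems] by blast
    then show "\<not> forces (pair_model W) (S, T) (Imp A B)"
      using Imp.IH[of S' T'] Imp.prems by (auto simp: acc)
  qed
qed

definition saturated_pairs :: "'v form set \<Rightarrow> ('v form set \<times> 'v form set) set" where
  "saturated_pairs \<Sigma> = {(S, T). \<exists>\<Gamma> \<Delta>. saturated_state \<Sigma> S T \<Gamma> \<Delta>}"

text \<open>After \<open>\<rightarrow>R\<close> the record \<open>S\<close> still fits: decomposition of its members refers to \<open>S\<close> alone, and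
  the members that are not decomposed stay in the antecedent of the sequent.\<close>

lemma saturated_pairs_ImpR:
  assumes fin: "finite \<Sigma>" and cl: "subformula_closed \<Sigma>"
    and st: "search_state \<Sigma> S T \<Gamma> \<Delta>" and Imp: "Imp A B \<in> T"
  shows "\<exists>S' T'. (S', T') \<in> saturated_pairs \<Sigma> \<and> S \<subseteq> S' \<and> A \<in> S' \<and> B \<in> T'"
proof -
  have "Imp A B \<in># \<Delta>" using st Imp by (auto simp: search_state_def)
  then obtain \<Delta>1 where "\<Delta> = add_mset (Imp A B) \<Delta>1" by (blast dest: multi_member_split)
  then have "\<not> G3Ti (add_mset A \<Gamma>) {#B#}" using st by (auto simp: search_state_def intro: G3Ti.ImpR)
  moreover have "A \<in> \<Sigma>" "B \<in> \<Sigma>"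
    using subformula_closedD(3)[OF cl, of A B] st Imp by (auto simp: search_state_def)
  ultimately have "search_state \<Sigma> (insert A S) {B} (add_mset A \<Gamma>) {#B#}"
    using st decomposedL_mono[OF _ subset_insertI[of S A]] by (auto simp: search_state_def)
  then obtain S' T' \<Gamma>' \<Delta>'
    where "saturated_state \<Sigma> S' T' \<Gamma>' \<Delta>'" "insert A S \<subseteq> S'" "{B} \<subseteq> T'"
    using saturation[OF fin cl] by meson
  then show ?thesis unfolding saturated_pairs_def by blast
qed

lemma hintikka_system_saturated_pairs:
  fixes \<Sigma> :: "'v form set"
  assumes fin: "finite \<Sigma>" and cl: "subformula_closed \<Sigma>"
  shows "hintikka_system (saturated_pairs \<Sigma>)"
proof
  fix S T :: "'v form set" and A B :: "'v form" and p
  assume "(S, T) \<in> saturated_pairs \<Sigma>"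
  then obtain \<Gamma> \<Delta> where st: "search_state \<Sigma> S T \<Gamma> \<Delta>"
    and satL: "\<forall>F\<in>#\<Gamma>. saturatedL T F" and satR: "\<forall>F\<in>#\<Delta>. saturatedR F"
    by (auto simp: saturated_pairs_def saturated_state_def)
  have L: "saturatedL T F \<or> decomposedL S F" if "F \<in> S" for F
    using st satL that by (auto simp: search_state_def)
  have R: "saturatedR F \<or> decomposedR T F" if "F \<in> T" for F
    using st satR that by (auto simp: search_state_def)
  show "Bot \<notin> S" using L[of Bot] by (auto simp: saturatedL_def)
  show "Var p \<notin> T" if "Var p \<in> S"
  proof
    assume "Var p \<in> T"
    \<comment> \<open>Variables never leave the sequent, so the current sequent would be initial.\<close>
    then have "Var p \<in># \<Gamma>" "Var p \<in># \<Delta>" using st that by (auto simp: search_state_def)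
    then have "G3Ti \<Gamma> \<Delta>" by (metis G3Ti.Init insert_DiffM)
    then show False using st by (simp add: search_state_def)
  qed
  show "A \<in> S \<and> B \<in> S" if "And A B \<in> S" using L[OF that] by (simp add: saturatedL_def)
  show "A \<in> S \<or> B \<in> S" if "Or A B \<in> S" using L[OF that] by (simp add: saturatedL_def)
  show "A \<in> T \<or> B \<in> S" if "Imp A B \<in> S" using L[OF that] by (simp add: saturatedL_def)
  show "A \<in> T \<or> B \<in> T" if "And A B \<in> T" using R[OF that] by (simp add: saturatedR_def)
  show "A \<in> T \<and> B \<in> T" if "Or A B \<in> T" using R[OF that] by (simp add: saturatedR_def)
  show "\<exists>S' T'. (S', T') \<in> saturated_pairs \<Sigma> \<and> S \<subseteq> S' \<and> A \<in> S' \<and> B \<in> T'" if "Imp A B \<in> T"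
    using saturated_pairs_ImpR[OF fin cl st that] .
qed

lemma saturated_pairs_bound:
  assumes "finite \<Sigma>"
  shows "finite (saturated_pairs \<Sigma>)" "card (saturated_pairs \<Sigma>) \<le> 4 ^ card \<Sigma>"
proof -
  have sub: "saturated_pairs \<Sigma> \<subseteq> Pow \<Sigma> \<times> Pow \<Sigma>"
    by (auto simp: saturated_pairs_def saturated_state_def search_state_def)
  have fin: "finite (Pow \<Sigma> \<times> Pow \<Sigma>)" using assms by simp
  show "finite (saturated_pairs \<Sigma>)" using finite_subset[OF sub fin] .
  have "card (saturated_pairs \<Sigma>) \<le> card (Pow \<Sigma> \<times> Pow \<Sigma>)" using card_mono[OF fin sub] .
  also have "\<dots> = 4 ^ card \<Sigma>"
    using assms by (simp add: card_cartesian_product card_Pow flip: power_mult_distrib)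
  finally show "card (saturated_pairs \<Sigma>) \<le> 4 ^ card \<Sigma>" .
qed

section \<open>Renaming the worlds\<close>

definition rename_worlds :: "('a \<Rightarrow> 'b) \<Rightarrow> ('a, 'v) kripke \<Rightarrow> ('b, 'v) kripke" where
  "rename_worlds f M = \<lparr>worlds = f ` worlds M, acc = {(f w, f v) |w v. (w, v) \<in> acc M},
                        val = \<lambda>x. val M (inv_into (worlds M) f x)\<rparr>"

lemma acc_rename_worlds:
  assumes "kripke_model M" "inj_on f (worlds M)" "w \<in> worlds M"
  shows "(f w, y) \<in> acc (rename_worlds f M) \<longleftrightarrow> (\<exists>v. y = f v \<and> (w, v) \<in> acc M)"
proof -
  have "w' = w" if "f w' = f w" "(w', v) \<in> acc M" for w' v
  proof -
    have "w' \<in> worlds M" using assms(1) that(2) by (auto simp: kripke_model_def preorder_on_def)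
    then show ?thesis using assms(2,3) that(1) by (simp add: inj_on_eq_iff)
  qed
  moreover have "(f w, y) \<in> acc (rename_worlds f M) \<longleftrightarrow>
      (\<exists>w' v. f w' = f w \<and> y = f v \<and> (w', v) \<in> acc M)"
    by (simp add: rename_worlds_def) metis
  ultimately show ?thesis by blast
qed

lemma kripke_model_rename_worlds:
  assumes M: "kripke_model M" and inj: "inj_on f (worlds M)"
  shows "kripke_model (rename_worlds f M)"
proof -
  have W: "acc M \<subseteq> worlds M \<times> worlds M" and re: "\<forall>w\<in>worlds M. (w, w) \<in> acc M"
    and tr: "\<And>x y z. (x, y) \<in> acc M \<Longrightarrow> (y, z) \<in> acc M \<Longrightarrow> (x, z) \<in> acc M"
    using M by (auto simp: kripke_model_def preorder_on_def refl_on_def dest: transD)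
  have rel: "(x, y) \<in> acc (rename_worlds f M) \<longleftrightarrow> (\<exists>w v. x = f w \<and> y = f v \<and> (w, v) \<in> acc M)"
    for x y by (auto simp: rename_worlds_def)
  have "trans (acc (rename_worlds f M))"
  proof (rule transI)
    fix x y z
    assume xy: "(x, y) \<in> acc (rename_worlds f M)" and yz: "(y, z) \<in> acc (rename_worlds f M)"
    obtain w v where wv: "x = f w" "y = f v" "(w, v) \<in> acc M" using xy rel by blast
    then have "v \<in> worlds M" using W by blast
    then obtain u where "z = f u" "(v, u) \<in> acc M"
      using yz acc_rename_worlds[OF M inj] unfolding wv(2) by blast
    then show "(x, z) \<in> acc (rename_worlds f M)" using tr[OF wv(3)] wv(1) rel by blast
  qed
  moreover have "val (rename_worlds f M) x \<subseteq> val (rename_worlds f M) y"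
    if xy: "(x, y) \<in> acc (rename_worlds f M)" for x y
  proof -
    obtain w v where wv: "x = f w" "y = f v" "(w, v) \<in> acc M" using xy rel by blast
    moreover have "w \<in> worlds M" "v \<in> worlds M" using W wv by auto
    moreover have "val M w \<subseteq> val M v" using M wv by (auto simp: kripke_model_def)
    ultimately show ?thesis using inj by (simp add: rename_worlds_def)
  qed
  moreover have "worlds (rename_worlds f M) \<noteq> {}"
    using M by (simp add: kripke_model_def rename_worlds_def)
  moreover have "refl_on (worlds (rename_worlds f M)) (acc (rename_worlds f M))"
    "acc (rename_worlds f M) \<subseteq> worlds (rename_worlds f M) \<times> worlds (rename_worlds f M)"
    using W re by (force simp: rename_worlds_def refl_on_def)+
  ultimately show ?thesis unfolding kripke_model_def preorder_on_def by blast
qed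

lemma forces_rename_worlds:
  assumes M: "kripke_model M" and inj: "inj_on f (worlds M)" and "w \<in> worlds M"
  shows "forces (rename_worlds f M) (f w) A \<longleftrightarrow> forces M w A"
  using assms(3)
proof (induction A arbitrary: w)
  case (Var p)
  then show ?case using inj by (simp add: rename_worlds_def)
next
  case (Imp A B)
  have "v \<in> worlds M" if "(w, v) \<in> acc M" for v
    using M that by (auto simp: kripke_model_def preorder_on_def)
  then show ?case using Imp by (auto simp: acc_rename_worlds[OF M inj])
qed auto

section \<open>Completeness\<close>

text \<open>The countermodel can live on any infinite type because it has finitely many worlds, and a
  finite set injects into every infinite type.\<close>

lemma finite_countermodel:
  fixes \<Gamma>0 \<Delta>0 :: "'v form multiset"
  assumes und: "\<not> G3Ti \<Gamma>0 \<Delta>0" and inf: "infinite (UNIV :: 'w set)"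
  shows "\<exists>(M :: ('w, 'v) kripke) w. kripke_model M \<and> finite (worlds M) \<and>
           card (worlds M) \<le> 4 ^ card (Sub (set_mset \<Gamma>0 \<union> set_mset \<Delta>0)) \<and>
           w \<in> worlds M \<and> (\<forall>A\<in>#\<Gamma>0. forces M w A) \<and> (\<forall>B\<in>#\<Delta>0. \<not> forces M w B)"
proof -
  define \<Sigma> where "\<Sigma> = Sub (set_mset \<Gamma>0 \<union> set_mset \<Delta>0)"
  define W where "W = saturated_pairs \<Sigma>"
  have fin: "finite \<Sigma>" and cl: "subformula_closed \<Sigma>"
    by (simp_all add: \<Sigma>_def finite_Sub subformula_closed_Sub)
  have "search_state \<Sigma> (set_mset \<Gamma>0) (set_mset \<Delta>0) \<Gamma>0 \<Delta>0"
    using und subset_Sub[of "set_mset \<Gamma>0 \<union> set_mset \<Delta>0"] by (simp add: search_state_def \<Sigma>_def)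
  then obtain S T where ST: "(S, T) \<in> W" "set_mset \<Gamma>0 \<subseteq> S" "set_mset \<Delta>0 \<subseteq> T"
    using saturation[OF fin cl] unfolding W_def saturated_pairs_def by blast
  let ?M = "pair_model W"
  have M: "kripke_model ?M" using ST by (auto intro: kripke_model_pair_model)
  have truth: "\<forall>A\<in>#\<Gamma>0. forces ?M (S, T) A" "\<forall>B\<in>#\<Delta>0. \<not> forces ?M (S, T) B"
    using hintikka_system.truth_lemma[OF hintikka_system_saturated_pairs[OF fin cl]] ST
    unfolding W_def by blast+
  have worlds: "worlds ?M = W" by (simp add: pair_model_def)
  have finW: "finite W" and cardW: "card W \<le> 4 ^ card \<Sigma>"
    using saturated_pairs_bound[OF fin] by (simp_all add: W_def)
  obtain U :: "'w set" where "finite U" "card U = card W"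
    using infinite_arbitrarily_large[OF inf, of "card W"] by blast
  then obtain f :: "_ \<Rightarrow> 'w" where "bij_betw f W U"
    using finite_same_card_bij[OF finW] by metis
  then have inj: "inj_on f (worlds ?M)" by (simp add: worlds bij_betw_def)
  let ?N = "rename_worlds f ?M"
  have "worlds ?N = f ` W" by (simp add: rename_worlds_def worlds)
  moreover have "card (f ` W) = card W" using inj by (simp add: worlds card_image)
  moreover have "forces ?N (f (S, T)) A \<longleftrightarrow> forces ?M (S, T) A" for A
    using forces_rename_worlds[OF M inj] ST worlds by simp
  moreover have "kripke_model ?N" using kripke_model_rename_worlds[OF M inj] .
  ultimately show ?thesis
    using truth finW cardW ST(1)
    by (intro exI[of _ ?N] exI[of _ "f (S, T)"]) (simp add: \<Sigma>_def)
qed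

theorem theorem5p8:
  fixes \<Gamma>0 \<Delta>0 :: "('v::countable) form multiset"
  shows "(\<not> G3Ti \<Gamma>0 \<Delta>0 \<longrightarrow>
           (\<exists>(M :: (nat, 'v) kripke) w.
              kripke_model M \<and> finite (worlds M) \<and>
              card (worlds M) \<le> 4 ^ card (Sub (set_mset \<Gamma>0 \<union> set_mset \<Delta>0)) \<and>
              w \<in> worlds M \<and>
              (\<forall>A\<in>#\<Gamma>0. forces M w A) \<and> (\<forall>B\<in>#\<Delta>0. \<not> forces M w B)))
       \<and> (G3Ti \<Gamma>0 \<Delta>0 \<longrightarrow> valid TYPE('w) \<Gamma>0 \<Delta>0)
       \<and> (infinite (UNIV :: 'w set) \<longrightarrow> (G3Ti \<Gamma>0 \<Delta>0 \<longleftrightarrow> valid TYPE('w) \<Gamma>0 \<Delta>0))"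
proof -
  have "G3Ti \<Gamma>0 \<Delta>0" if "infinite (UNIV :: 'w set)" "valid TYPE('w) \<Gamma>0 \<Delta>0"
    using finite_countermodel[OF _ that(1)] that(2) unfolding valid_def by blast
  then show ?thesis
    using finite_countermodel[OF _ infinite_UNIV_nat] soundness by blast
qed

end
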